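(* Let $n\ge 5$. Then scenery reconstruction is impossible for the $n$-dimensional hypercube: there is no measurable map $R$ from $\{-1,1\}^{\mathbb{N}}$ to the set of functions $\{-1,1\}^n\to\{-1,1\}$ such that for every $f:\{-1,1\}^n\to\{-1,1\}$, with probability $1$ the function $R\big((f(S_i))_{i\ge 0}\big)$ is isomorphic to $f$.
   Context: The hypercube $\{-1,1\}^n$ is regarded as a graph in which two vertices are adjacent iff they differ in exactly one coordinate. $(S_i)_{i\geq 0}$ denotes simple random walk on this graph: $S_0$ is uniformly distributed over the vertices and, given the past, $S_{i+1}$ is a uniformly random neighbor of $S_i$. The scenery process of $f$ is $(f(S_i))_{i\ge 0}$. Two functions $f,g:\{-1,1\}^n\to\{-1,1\}$ are isomorphic if there is a graph automorphism $\psi$ of the hypercube with $f\circ\psi=g$. *)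

theory Defs
  imports "HOL-Probability.Probability"
begin

section \<open>The hypercube\<close>

type_synonym vertex = "nat \<Rightarrow> int"

text \<open>Coordinates are indexed by \<open>{..<n}\<close>; outside this set a vertex is \<open>undefined\<close>, so that
  equality of vertices is equality of their \<open>n\<close> coordinates. Functions on the hypercube are
  treated in the same way.\<close>

definition hypercube :: "nat \<Rightarrow> vertex set" where
  "hypercube n = {..<n} \<rightarrow>\<^sub>E {-1, 1}"

definition hypercube_adj :: "nat \<Rightarrow> vertex \<Rightarrow> vertex \<Rightarrow> bool" where
  "hypercube_adj n x y \<longleftrightarrow> (\<exists>!i. i < n \<and> x i \<noteq> y i)"

abbreviation hypercube_functions :: "nat \<Rightarrow> (vertex \<Rightarrow> int) set" where
  "hypercube_functions n \<equiv> hypercube n \<rightarrow>\<^sub>E {-1, 1}"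

definition graph_automorphism :: "'v set \<Rightarrow> ('v \<Rightarrow> 'v \<Rightarrow> bool) \<Rightarrow> ('v \<Rightarrow> 'v) \<Rightarrow> bool" where
  "graph_automorphism V E \<psi> \<longleftrightarrow>
     bij_betw \<psi> V V \<and> (\<forall>x\<in>V. \<forall>y\<in>V. E (\<psi> x) (\<psi> y) \<longleftrightarrow> E x y)"

definition isomorphic_functions :: "nat \<Rightarrow> (vertex \<Rightarrow> int) \<Rightarrow> (vertex \<Rightarrow> int) \<Rightarrow> bool" where
  "isomorphic_functions n f g \<longleftrightarrow>
     (\<exists>\<psi>. graph_automorphism (hypercube n) (hypercube_adj n) \<psi> \<and>
          (\<forall>x\<in>hypercube n. f (\<psi> x) = g x))"


section \<open>Simple random walk and its sceneries\<close>

text \<open>Simple random walk with uniform starting point on a finite graph with vertex set \<open>V\<close> and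
  adjacency relation \<open>E\<close>. As \<open>V\<close> is finite, conditioning on the past amounts to conditioning on
  the events \<open>S 0 = v 0, \<dots>, S k = v k\<close> of positive probability.\<close>

definition simple_random_walk ::
  "'v set \<Rightarrow> ('v \<Rightarrow> 'v \<Rightarrow> bool) \<Rightarrow> 'a measure \<Rightarrow> (nat \<Rightarrow> 'a \<Rightarrow> 'v) \<Rightarrow> bool" where
  "simple_random_walk V E M S \<longleftrightarrow>
     prob_space M \<and>
     (\<forall>i. S i \<in> M \<rightarrow>\<^sub>M count_space V) \<and>
     (\<forall>v\<in>V. \<P>(\<omega> in M. S 0 \<omega> = v) = 1 / card V) \<and>
     (\<forall>k v. \<forall>w\<in>V. \<P>(\<omega> in M. \<forall>i\<le>k. S i \<omega> = v i) > 0 \<longrightarrow>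
        \<P>(\<omega> in M. S (Suc k) \<omega> = w \<bar> \<forall>i\<le>k. S i \<omega> = v i) =
          (if E (v k) w then 1 / card {u\<in>V. E (v k) u} else 0))"

definition scenery :: "('v \<Rightarrow> int) \<Rightarrow> (nat \<Rightarrow> 'a \<Rightarrow> 'v) \<Rightarrow> 'a \<Rightarrow> nat \<Rightarrow> int" where
  "scenery f S \<omega> = (\<lambda>i. f (S i \<omega>))"

abbreviation sign_sequences :: "(nat \<Rightarrow> int) measure" where
  "sign_sequences \<equiv> \<Pi>\<^sub>M i\<in>UNIV. count_space {-1, 1}"

end

theory Submission
  imports Defs
begin

text \<open>
  Call a two-valued function on a \<open>d\<close>-regular graph locally stable if every vertex has the
  same number \<open>c\<close> of neighbours of the other value. Whatever the walk has done so far, its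
  next step then changes the value with probability \<open>c / d\<close>. Hence the scenery is a two-state
  Markov chain whose flip probability depends on \<open>c\<close> and \<open>d\<close> only, and for \<open>c > 0\<close> the starting
  value is uniform because the edges between the two value classes can be counted from either
  side (\<open>locally_stable_prefix\<close>). So any two locally stable functions with the same \<open>d\<close> and
  \<open>c > 0\<close> have sceneries with the same law (\<open>locally_stable_scenery_law\<close>). A reconstruction
  map that worked for both would, on almost every sequence drawn from that common law, return
  a function isomorphic to both (\<open>equal_scenery_laws_common_reconstruction\<close>).

  It remains to find two locally stable functions on the hypercube that have the same \<open>c\<close> and
  are not isomorphic. With \<open>c = 2\<close> one can take \<open>x 0 * x 1\<close> and the function that equals
  \<open>x 0 * x 2\<close> where \<open>x 2 = x 3\<close> and \<open>x 1 * x 2\<close> elsewhere. In terms of Fourier analysis, a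
  function with values \<open>-1\<close> and \<open>1\<close> is locally stable iff it is an eigenfunction of the
  adjacency operator, that is, iff all its Fourier weight lies on one level. Both functions
  live on level two: the second one is
  \<open>(x 0 * x 2 + x 0 * x 3 + x 1 * x 2 - x 1 * x 3) / 2\<close>. They are told apart by the 4-cycles
  of the cube. A character such as \<open>x 0 * x 1\<close> has product \<open>1\<close> over every 4-cycle, whereas the
  second function takes the values \<open>1, -1, -1, -1\<close> on some 4-cycle
  (\<open>product_fn_no_odd_square\<close>, \<open>switch_fn_odd_square\<close>).
\<close>

section \<open>Locally stable functions and their sceneries\<close>

definition locally_stable ::
  "'v set \<Rightarrow> ('v \<Rightarrow> 'v \<Rightarrow> bool) \<Rightarrow> nat \<Rightarrow> nat \<Rightarrow> ('v \<Rightarrow> int) \<Rightarrow> bool" where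
  "locally_stable V E d c f \<longleftrightarrow> f \<in> V \<rightarrow> {-1, 1} \<and>
     (\<forall>v\<in>V. card {u\<in>V. E v u} = d \<and> card {u\<in>V. E v u \<and> f u \<noteq> f v} = c)"

text \<open>Double counting: each class sends exactly \<open>c\<close> edges per vertex to the other one, so the
  two classes have the same size.\<close>

lemma locally_stable_balanced:
  assumes f: "locally_stable V E d c f" and V: "finite V" "V \<noteq> {}" and c: "c > 0"
    and sym: "\<And>x y. E x y \<longleftrightarrow> E y x"
    and a: "a \<in> {-1, 1}"
  shows "real (card {v\<in>V. f v = a}) / real (card V) = 1 / 2"
proof -
  let ?C = "\<lambda>a. {v\<in>V. f v = a}"
  have range: "f v = -1 \<or> f v = 1" if "v \<in> V" for v
    using f that by (auto simp: locally_stable_def)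
  have other: "card {u \<in> ?C (-a). E v u} = c" if "v \<in> ?C a" "a \<in> {-1, 1}" for v a
  proof -
    have "{u \<in> ?C (-a). E v u} = {u\<in>V. E v u \<and> f u \<noteq> f v}"
      using that range by fastforce
    then show ?thesis
      using f that(1) by (auto simp: locally_stable_def)
  qed
  have "(\<Sum>v\<in>?C a. card {u \<in> ?C (-a). E v u}) = c * card (?C (-a))"
    using V other[of _ "-a"] a by (intro sum_multicount) (auto simp: sym)
  then have "card (?C a) = card (?C (-a))"
    using other[OF _ a] c by simp
  moreover have "card V = card (?C a) + card (?C (-a))"
  proof -
    have "V = ?C a \<union> ?C (-a)"
      using range a by fastforce
    moreover have "?C a \<inter> ?C (-a) = {}"
      using a by auto
    ultimately show ?thesis
      using V by (metis card_Un_disjoint finite_Un)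
  qed
  moreover have "card V > 0"
    using V by (simp add: card_gt_0_iff)
  ultimately show ?thesis
    by (simp add: field_simps)
qed

lemma measurable_value_event:
  assumes "X \<in> M \<rightarrow>\<^sub>M count_space V"
  shows "{\<omega>\<in>space M. P (X \<omega>)} \<in> sets M"
proof -
  have "{\<omega>\<in>space M. P (X \<omega>)} = X -` {v\<in>V. P v} \<inter> space M"
    using measurable_space[OF assms] by auto
  then show ?thesis
    using measurable_sets[OF assms, of "{v\<in>V. P v}"] by auto
qed

lemma measurable_path_event:
  assumes "\<And>i. S i \<in> M \<rightarrow>\<^sub>M count_space V"
  shows "{\<omega>\<in>space M. \<forall>i\<le>(k::nat). P i (S i \<omega>)} \<in> sets M"
proof -
  have "{\<omega>\<in>space M. \<forall>i\<in>{..k}. P i (S i \<omega>)} \<in> sets M"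
  proof (rule sets.sets_Collect_finite_All)
    show "{\<omega>\<in>space M. P i (S i \<omega>)} \<in> sets M" for i
      by (rule measurable_value_event[OF assms, of "P i"])
  qed simp
  then show ?thesis
    by (simp only: Ball_def atMost_iff)
qed

text \<open>The Markov property without conditioning: a path of probability zero makes both sides
  vanish.\<close>

lemma walk_path_extend:
  assumes walk: "simple_random_walk V E M S" and w: "w \<in> V"
  shows "\<P>(\<omega> in M. (\<forall>i\<le>k. S i \<omega> = v i) \<and> S (Suc k) \<omega> = w) =
    \<P>(\<omega> in M. \<forall>i\<le>k. S i \<omega> = v i) * (if E (v k) w then 1 / card {u\<in>V. E (v k) u} else 0)"
proof -
  interpret prob_space M
    using walk by (simp add: simple_random_walk_def)
  have meas: "S i \<in> M \<rightarrow>\<^sub>M count_space V" for i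
    using walk by (simp add: simple_random_walk_def)
  let ?path = "\<P>(\<omega> in M. \<forall>i\<le>k. S i \<omega> = v i)"
  let ?ext = "\<P>(\<omega> in M. (\<forall>i\<le>k. S i \<omega> = v i) \<and> S (Suc k) \<omega> = w)"
  show ?thesis
  proof (cases "?path > 0")
    case True
    then have "\<P>(\<omega> in M. S (Suc k) \<omega> = w \<bar> \<forall>i\<le>k. S i \<omega> = v i) =
        (if E (v k) w then 1 / card {u\<in>V. E (v k) u} else 0)"
      using walk w unfolding simple_random_walk_def by blast
    then show ?thesis
      using True by (simp add: cond_prob_def field_simps conj_commute split: if_splits)
  next
    case False
    then have 0: "?path = 0"
      by (simp add: zero_less_measure_iff)
    have "?ext \<le> ?path"
      by (rule finite_measure_mono[OF _ measurable_path_event[OF meas, of k "\<lambda>i s. s = v i"]]) auto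
    then have "?ext = 0"
      using 0 measure_nonneg[of M] by (simp add: order_antisym)
    with 0 show ?thesis
      by simp
  qed
qed

text \<open>Split the event that the first values are \<open>a 0, \<dots>, a k\<close> according to the path that the walk
  has taken. On each path the next value is \<open>a (Suc k)\<close> with the same probability, since this
  probability depends on the current vertex only through its value \<open>a k\<close>. So it factors out
  of the sum over paths.\<close>

lemma locally_stable_prefix_extend:
  assumes walk: "simple_random_walk V E M S" and V: "finite V"
    and f: "locally_stable V E d c f" and d: "d > 0" and a: "a (Suc k) \<in> {-1, 1}"
  shows "\<P>(\<omega> in M. \<forall>i\<le>Suc k. f (S i \<omega>) = a i) =
    \<P>(\<omega> in M. \<forall>i\<le>k. f (S i \<omega>) = a i) *
      ((if a (Suc k) = a k then real d - real c else real c) / real d)"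
proof -
  interpret prob_space M
    using walk by (simp add: simple_random_walk_def)
  have meas: "S i \<in> M \<rightarrow>\<^sub>M count_space V" for i
    using walk by (simp add: simple_random_walk_def)
  have inV: "S i \<omega> \<in> V" if "\<omega> \<in> space M" for i \<omega>
    using measurable_space[OF meas that] by simp
  let ?q = "(if a (Suc k) = a k then real d - real c else real c) / real d"
  define paths where "paths = {v \<in> {..k} \<rightarrow>\<^sub>E V. \<forall>i\<le>k. f (v i) = a i}"
  define W where "W = {w\<in>V. f w = a (Suc k)}"
  have fin: "finite paths" "finite W"
    using V by (simp_all add: paths_def W_def finite_PiE)
  have path: "\<exists>!v\<in>paths. \<forall>i\<le>k. S i \<omega> = v i"
    if "\<omega> \<in> space M" "\<forall>i\<le>k. f (S i \<omega>) = a i" for \<omega>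
  proof (intro ex1I[of _ "\<lambda>i\<in>{..k}. S i \<omega>"] conjI)
    show "(\<lambda>i\<in>{..k}. S i \<omega>) \<in> paths"
      using that inV by (auto simp: paths_def)
    show "v = (\<lambda>i\<in>{..k}. S i \<omega>)" if "v \<in> paths \<and> (\<forall>i\<le>k. S i \<omega> = v i)" for v
      using that by (intro ext) (auto simp: paths_def PiE_def extensional_def)
  qed auto
  have prefix: "\<P>(\<omega> in M. \<forall>i\<le>k. f (S i \<omega>) = a i) =
      (\<Sum>v\<in>paths. \<P>(\<omega> in M. \<forall>i\<le>k. S i \<omega> = v i))"
  proof (rule prob_sum)
    show "finite paths"
      by (rule fin)
    show "{\<omega>\<in>space M. \<forall>i\<le>k. S i \<omega> = v i} \<in> events" for v
      by (rule measurable_path_event[OF meas, of k "\<lambda>i s. s = v i"])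
    show "{\<omega>\<in>space M. \<forall>i\<le>k. f (S i \<omega>) = a i} \<in> events"
      by (rule measurable_path_event[OF meas, of k "\<lambda>i s. f s = a i"])
    show "AE \<omega> in M. (\<forall>v\<in>paths. (\<forall>i\<le>k. S i \<omega> = v i) \<longrightarrow> (\<forall>i\<le>k. f (S i \<omega>) = a i)) \<and>
        ((\<forall>i\<le>k. f (S i \<omega>) = a i) \<longrightarrow> (\<exists>!v\<in>paths. \<forall>i\<le>k. S i \<omega> = v i))"
    proof (rule AE_I2, rule conjI)
      fix \<omega> assume \<omega>: "\<omega> \<in> space M"
      show "\<forall>v\<in>paths. (\<forall>i\<le>k. S i \<omega> = v i) \<longrightarrow> (\<forall>i\<le>k. f (S i \<omega>) = a i)"
        by (simp add: paths_def)
      show "(\<forall>i\<le>k. f (S i \<omega>) = a i) \<longrightarrow> (\<exists>!v\<in>paths. \<forall>i\<le>k. S i \<omega> = v i)"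
        using path[OF \<omega>] by blast
    qed
  qed
  have next_colour: "(\<Sum>w\<in>W. if E (v k) w then 1 / real (card {u\<in>V. E (v k) u}) else 0) = ?q"
    if v: "v \<in> paths" for v
  proof -
    have vk: "v k \<in> V" "f (v k) = a k"
      using v by (auto simp: paths_def)
    let ?N = "{u\<in>V. E (v k) u}" and ?D = "{u\<in>V. E (v k) u \<and> f u \<noteq> f (v k)}"
    have card: "card ?N = d" "card ?D = c"
      using f vk by (auto simp: locally_stable_def)
    have range: "f u = -1 \<or> f u = 1" if "u \<in> V" for u
      using f that by (auto simp: locally_stable_def)
    have "real (card {w\<in>W. E (v k) w}) = (if a (Suc k) = a k then real d - real c else real c)"
    proof (cases "a (Suc k) = a k")
      case True
      then have "{w\<in>W. E (v k) w} = ?N - ?D"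
        using vk by (auto simp: W_def)
      moreover have "card (?N - ?D) = card ?N - card ?D"
        using V by (intro card_Diff_subset) auto
      moreover have "card ?D \<le> card ?N"
        using V by (intro card_mono) auto
      ultimately show ?thesis
        using True card by simp
    next
      case False
      have "f u = a (Suc k) \<longleftrightarrow> f u \<noteq> f (v k)" if "u \<in> V" for u
        using False vk(2) a range[OF that] range[OF vk(1)] by auto
      then have "{w\<in>W. E (v k) w} = ?D"
        by (auto simp: W_def)
      then show ?thesis
        using False card by simp
    qed
    moreover have "(\<Sum>w\<in>W. if E (v k) w then 1 / real (card ?N) else 0) =
        real (card {w\<in>W. E (v k) w}) / real d"
      using fin by (simp add: card sum.If_cases Int_def)
    ultimately show ?thesis
      by simp
  qed
  have "\<P>(\<omega> in M. \<forall>i\<le>Suc k. f (S i \<omega>) = a i) =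
      (\<Sum>p\<in>paths \<times> W. \<P>(\<omega> in M. (\<forall>i\<le>k. S i \<omega> = fst p i) \<and> S (Suc k) \<omega> = snd p))"
  proof (rule prob_sum)
    show "finite (paths \<times> W)"
      using fin by simp
    show "{\<omega>\<in>space M. (\<forall>i\<le>k. S i \<omega> = fst p i) \<and> S (Suc k) \<omega> = snd p} \<in> events" for p
    proof (rule sets.sets_Collect_conj)
      show "{\<omega>\<in>space M. \<forall>i\<le>k. S i \<omega> = fst p i} \<in> events"
        by (rule measurable_path_event[OF meas, of k "\<lambda>i s. s = fst p i"])
      show "{\<omega>\<in>space M. S (Suc k) \<omega> = snd p} \<in> events"
        by (rule measurable_value_event[OF meas, of "\<lambda>s. s = snd p"])
    qed
    show "{\<omega>\<in>space M. \<forall>i\<le>Suc k. f (S i \<omega>) = a i} \<in> events"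
      by (rule measurable_path_event[OF meas, of "Suc k" "\<lambda>i s. f s = a i"])
    show "AE \<omega> in M. (\<forall>p\<in>paths \<times> W. (\<forall>i\<le>k. S i \<omega> = fst p i) \<and> S (Suc k) \<omega> = snd p \<longrightarrow>
          (\<forall>i\<le>Suc k. f (S i \<omega>) = a i)) \<and>
        ((\<forall>i\<le>Suc k. f (S i \<omega>) = a i) \<longrightarrow>
          (\<exists>!p\<in>paths \<times> W. (\<forall>i\<le>k. S i \<omega> = fst p i) \<and> S (Suc k) \<omega> = snd p))"
    proof (rule AE_I2, rule conjI)
      fix \<omega> assume \<omega>: "\<omega> \<in> space M"
      show "\<forall>p\<in>paths \<times> W. (\<forall>i\<le>k. S i \<omega> = fst p i) \<and> S (Suc k) \<omega> = snd p \<longrightarrow>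
          (\<forall>i\<le>Suc k. f (S i \<omega>) = a i)"
        by (auto simp: paths_def W_def le_Suc_eq)
      show "(\<forall>i\<le>Suc k. f (S i \<omega>) = a i) \<longrightarrow>
          (\<exists>!p\<in>paths \<times> W. (\<forall>i\<le>k. S i \<omega> = fst p i) \<and> S (Suc k) \<omega> = snd p)"
      proof
        assume *: "\<forall>i\<le>Suc k. f (S i \<omega>) = a i"
        then obtain v where "v \<in> paths" "\<forall>i\<le>k. S i \<omega> = v i"
          and "\<And>u. u \<in> paths \<Longrightarrow> \<forall>i\<le>k. S i \<omega> = u i \<Longrightarrow> u = v"
          using path[OF \<omega>] by (metis le_SucI)
        moreover have "S (Suc k) \<omega> \<in> W"
          using * inV[OF \<omega>] by (simp add: W_def)
        ultimately show "\<exists>!p\<in>paths \<times> W. (\<forall>i\<le>k. S i \<omega> = fst p i) \<and> S (Suc k) \<omega> = snd p"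
          by (intro ex1I[of _ "(v, S (Suc k) \<omega>)"]) auto
      qed
    qed
  qed
  also have "\<dots> = (\<Sum>v\<in>paths. \<Sum>w\<in>W. \<P>(\<omega> in M. \<forall>i\<le>k. S i \<omega> = v i) *
      (if E (v k) w then 1 / real (card {u\<in>V. E (v k) u}) else 0))"
    unfolding sum.cartesian_product
    by (intro sum.cong refl) (auto simp: walk_path_extend[OF walk] W_def)
  also have "\<dots> = (\<Sum>v\<in>paths. \<P>(\<omega> in M. \<forall>i\<le>k. S i \<omega> = v i) * ?q)"
    by (intro sum.cong refl) (simp only: sum_distrib_left[symmetric] next_colour)
  finally show ?thesis
    by (simp only: prefix sum_distrib_right)
qed

lemma locally_stable_prefix:
  assumes walk: "simple_random_walk V E M S" and V: "finite V" "V \<noteq> {}"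
    and sym: "\<And>x y. E x y \<longleftrightarrow> E y x"
    and f: "locally_stable V E d c f" and dc: "d > 0" "c > 0" and a: "\<And>i. i \<le> k \<Longrightarrow> a i \<in> {-1, 1}"
  shows "\<P>(\<omega> in M. \<forall>i\<le>k. f (S i \<omega>) = a i) =
    1 / 2 * (\<Prod>i<k. (if a (Suc i) = a i then real d - real c else real c) / real d)"
  using a
proof (induction k)
  case 0
  interpret prob_space M
    using walk by (simp add: simple_random_walk_def)
  have meas: "S i \<in> M \<rightarrow>\<^sub>M count_space V" for i
    using walk by (simp add: simple_random_walk_def)
  have start: "\<P>(\<omega> in M. S 0 \<omega> = v) = 1 / real (card V)" if "v \<in> V" for v
    using walk that unfolding simple_random_walk_def by blast
  have "\<P>(\<omega> in M. f (S 0 \<omega>) = a 0) = (\<Sum>v\<in>{v\<in>V. f v = a 0}. \<P>(\<omega> in M. S 0 \<omega> = v))"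
  proof (rule prob_sum)
    show "{\<omega>\<in>space M. S 0 \<omega> = v} \<in> events" for v
      by (rule measurable_value_event[OF meas, of "\<lambda>s. s = v"])
    show "{\<omega>\<in>space M. f (S 0 \<omega>) = a 0} \<in> events"
      by (rule measurable_value_event[OF meas, of "\<lambda>s. f s = a 0"])
    show "AE \<omega> in M. (\<forall>v\<in>{v\<in>V. f v = a 0}. S 0 \<omega> = v \<longrightarrow> f (S 0 \<omega>) = a 0) \<and>
        (f (S 0 \<omega>) = a 0 \<longrightarrow> (\<exists>!v\<in>{v\<in>V. f v = a 0}. S 0 \<omega> = v))"
      using measurable_space[OF meas[of 0]] by (intro AE_I2) auto
  qed (use V in simp)
  also have "\<dots> = 1 / 2"
    using locally_stable_balanced[OF f V dc(2) sym, of "a 0"] 0 by (simp add: start)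
  finally show ?case
    by simp
next
  case (Suc k)
  have "\<P>(\<omega> in M. \<forall>i\<le>k. f (S i \<omega>) = a i) =
      1 / 2 * (\<Prod>i<k. (if a (Suc i) = a i then real d - real c else real c) / real d)"
    by (rule Suc.IH[OF Suc.prems[OF le_SucI]])
  then show ?case
    by (simp only: locally_stable_prefix_extend[of V E M S d c f a k, OF walk V(1) f dc(1) Suc.prems[OF order_refl]]
        prod.lessThan_Suc mult.assoc)
qed

lemma scenery_measurable:
  assumes meas: "\<And>i. S i \<in> M \<rightarrow>\<^sub>M count_space V" and f: "f \<in> V \<rightarrow> {-1, 1}"
  shows "scenery f S \<in> M \<rightarrow>\<^sub>M sign_sequences"
proof (rule measurable_PiM_single)
  show "scenery f S \<in> space M \<rightarrow> (\<Pi>\<^sub>E i\<in>UNIV. space (count_space {-1, 1}))"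
    using f measurable_space[OF meas] by (fastforce simp: scenery_def)
  show "{\<omega> \<in> space M. scenery f S \<omega> i \<in> A} \<in> sets M" for i A
    unfolding scenery_def by (rule measurable_value_event[OF meas, of "\<lambda>s. f s \<in> A"])
qed

text \<open>A cylinder set in the space of sign sequences constrains finitely many coordinates, hence
  is a finite disjoint union of events that prescribe an initial segment.\<close>

lemma scenery_law_eqI:
  assumes prob: "prob_space M" and meas: "\<And>i. S i \<in> M \<rightarrow>\<^sub>M count_space V"
    and f: "f \<in> V \<rightarrow> {-1, 1}" and g: "g \<in> V \<rightarrow> {-1, 1}"
    and eq: "\<And>k a. (\<And>i. i \<le> k \<Longrightarrow> a i \<in> {-1, 1}) \<Longrightarrow>
      \<P>(\<omega> in M. \<forall>i\<le>k. f (S i \<omega>) = a i) = \<P>(\<omega> in M. \<forall>i\<le>k. g (S i \<omega>) = a i)"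
  shows "distr M sign_sequences (scenery f S) = distr M sign_sequences (scenery g S)"
proof (rule measure_eqI_PiM_infinite)
  interpret prob_space M by (rule prob)
  interpret P: prob_space "distr M sign_sequences (scenery f S)"
    by (rule prob_space_distr[OF scenery_measurable[OF meas f]])
  interpret Q: prob_space "distr M sign_sequences (scenery g S)"
    by (rule prob_space_distr[OF scenery_measurable[OF meas g]])
  show "finite_measure (distr M sign_sequences (scenery f S))"
    by unfold_locales
  fix A :: "nat \<Rightarrow> int set" and J :: "nat set"
  assume J: "finite J" "J \<subseteq> UNIV" and A: "\<And>i. i \<in> J \<Longrightarrow> A i \<in> sets (count_space {-1, 1})"
  let ?C = "prod_emb UNIV (\<lambda>_. count_space {-1, 1}) J (Pi\<^sub>E J A)"
  obtain k where k: "J \<subseteq> {..k}"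
    using finite_nat_iff_bounded_le J by auto
  define B where "B = {a \<in> {..k} \<rightarrow>\<^sub>E {-1, 1}. \<forall>i\<in>J. a i \<in> A i}"
  have finB: "finite B"
    unfolding B_def by (intro finite_subset[OF _ finite_PiE[of "{..k}" "\<lambda>_. {-1, 1}"]]) auto
  have C: "?C \<in> sets sign_sequences"
    using J A by (intro sets_PiM_I) auto
  have cylinder: "measure (distr M sign_sequences (scenery h S)) ?C =
      (\<Sum>a\<in>B. \<P>(\<omega> in M. \<forall>i\<le>k. h (S i \<omega>) = a i))" if h: "h \<in> V \<rightarrow> {-1, 1}" for h
  proof -
    have hS: "h (S i \<omega>) \<in> {-1, 1}" if "\<omega> \<in> space M" for i \<omega>
      using measurable_space[OF meas that] h by auto
    have "scenery h S -` ?C \<inter> space M = {\<omega>\<in>space M. \<forall>i\<in>J. h (S i \<omega>) \<in> A i}"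
      using hS A by (auto simp: scenery_def prod_emb_def PiE_iff)
    then have "measure (distr M sign_sequences (scenery h S)) ?C =
        \<P>(\<omega> in M. \<forall>i\<in>J. h (S i \<omega>) \<in> A i)"
      using C by (simp add: measure_distr[OF scenery_measurable[OF meas h]])
    also have "\<dots> = (\<Sum>a\<in>B. \<P>(\<omega> in M. \<forall>i\<le>k. h (S i \<omega>) = a i))"
    proof (intro prob_sum finB AE_I2 conjI impI)
      show "{\<omega>\<in>space M. \<forall>i\<in>J. h (S i \<omega>) \<in> A i} \<in> sets M"
      proof (rule sets.sets_Collect_finite_All)
        show "{\<omega>\<in>space M. h (S i \<omega>) \<in> A i} \<in> sets M" for i
          by (rule measurable_value_event[OF meas, of "\<lambda>s. h s \<in> A i"])
      qed (rule J)
      show "{\<omega>\<in>space M. \<forall>i\<le>k. h (S i \<omega>) = a i} \<in> sets M" for a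
        by (rule measurable_path_event[OF meas, of k "\<lambda>i s. h s = a i"])
      fix \<omega> assume \<omega>: "\<omega> \<in> space M"
      show "\<forall>a\<in>B. (\<forall>i\<le>k. h (S i \<omega>) = a i) \<longrightarrow> (\<forall>i\<in>J. h (S i \<omega>) \<in> A i)"
        using k by (fastforce simp: B_def)
      assume *: "\<forall>i\<in>J. h (S i \<omega>) \<in> A i"
      show "\<exists>!a\<in>B. \<forall>i\<le>k. h (S i \<omega>) = a i"
      proof (intro ex1I[of _ "\<lambda>i\<in>{..k}. h (S i \<omega>)"] conjI)
        show "(\<lambda>i\<in>{..k}. h (S i \<omega>)) \<in> B"
          using * hS[OF \<omega>] k by (auto simp: B_def)
        show "a = (\<lambda>i\<in>{..k}. h (S i \<omega>))" if "a \<in> B \<and> (\<forall>i\<le>k. h (S i \<omega>) = a i)" for a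
          using that by (intro ext) (auto simp: B_def PiE_def extensional_def)
      qed auto
    qed
    finally show ?thesis .
  qed
  have "measure (distr M sign_sequences (scenery f S)) ?C =
      measure (distr M sign_sequences (scenery g S)) ?C"
    unfolding cylinder[OF f] cylinder[OF g]
    by (intro sum.cong refl eq) (auto simp: B_def)
  then show "emeasure (distr M sign_sequences (scenery f S)) ?C =
      emeasure (distr M sign_sequences (scenery g S)) ?C"
    by (simp add: P.emeasure_eq_measure Q.emeasure_eq_measure)
qed (rule sets_distr)+

lemma locally_stable_scenery_law:
  assumes walk: "simple_random_walk V E M S" and V: "finite V" "V \<noteq> {}"
    and sym: "\<And>x y. E x y \<longleftrightarrow> E y x"
    and f: "locally_stable V E d c f" and g: "locally_stable V E d c g"
    and dc: "d > 0" "c > 0"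
  shows "distr M sign_sequences (scenery f S) = distr M sign_sequences (scenery g S)"
proof (rule scenery_law_eqI)
  show "prob_space M" "\<And>i. S i \<in> M \<rightarrow>\<^sub>M count_space V"
    using walk by (simp_all add: simple_random_walk_def)
  show "f \<in> V \<rightarrow> {-1, 1}" "g \<in> V \<rightarrow> {-1, 1}"
    using f g by (simp_all add: locally_stable_def)
  show "\<P>(\<omega> in M. \<forall>i\<le>k. f (S i \<omega>) = a i) = \<P>(\<omega> in M. \<forall>i\<le>k. g (S i \<omega>) = a i)"
    if "\<And>i. i \<le> k \<Longrightarrow> a i \<in> {-1, 1}" for k a
    by (simp only: locally_stable_prefix[OF walk V sym f dc that]
        locally_stable_prefix[OF walk V sym g dc that])
qed


section \<open>Indistinguishable functions cannot be reconstructed\<close>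

text \<open>Under the common law of the two sceneries both \<open>P\<close> and \<open>Q\<close> hold almost surely for the
  reconstructed value, and a set of probability one is not empty.\<close>

lemma equal_scenery_laws_common_reconstruction:
  assumes prob: "prob_space M"
    and meas: "scenery f S \<in> M \<rightarrow>\<^sub>M sign_sequences" "scenery g S \<in> M \<rightarrow>\<^sub>M sign_sequences"
    and law: "distr M sign_sequences (scenery f S) = distr M sign_sequences (scenery g S)"
    and R: "R \<in> sign_sequences \<rightarrow>\<^sub>M count_space F"
    and Pf: "AE \<omega> in M. P (R (scenery f S \<omega>))" and Qg: "AE \<omega> in M. Q (R (scenery g S \<omega>))"
  shows "\<exists>h\<in>F. P h \<and> Q h"
proof -
  let ?L = "distr M sign_sequences (scenery f S)"
  interpret L: prob_space ?L
    by (rule prob_space.prob_space_distr[OF prob meas(1)])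
  have pred: "{x \<in> space sign_sequences. X (R x)} \<in> sets sign_sequences" for X
    by (rule measurable_value_event[OF R])
  have "AE x in ?L. P (R x)"
    using Pf by (subst AE_distr_iff[OF meas(1) pred])
  moreover have "AE x in ?L. Q (R x)"
    unfolding law using Qg by (subst AE_distr_iff[OF meas(2) pred])
  ultimately have "AE x in ?L. x \<in> space ?L \<and> P (R x) \<and> Q (R x)"
    using AE_space by eventually_elim auto
  then obtain x where x: "x \<in> space sign_sequences" "P (R x)" "Q (R x)"
    using eventually_happens'[OF L.ae_filter_bot] unfolding space_distr by blast
  show ?thesis
    using measurable_space[OF R x(1)] x(2,3) unfolding space_count_space by blast
qed


section \<open>Two locally stable functions on the hypercube\<close>

lemma finite_hypercube: "finite (hypercube n)"
  by (simp add: hypercube_def finite_PiE)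

lemma hypercube_nonempty: "hypercube n \<noteq> {}"
  by (simp add: hypercube_def PiE_eq_empty_iff)

lemma hypercube_adj_sym: "hypercube_adj n x y \<longleftrightarrow> hypercube_adj n y x"
  by (simp add: hypercube_adj_def eq_commute)

lemma hypercube_coordinate:
  assumes "x \<in> hypercube n" "i < n"
  shows "x i = -1 \<or> x i = 1"
  using assms by (auto simp: hypercube_def PiE_iff)

definition flip :: "nat \<Rightarrow> vertex \<Rightarrow> vertex" where
  "flip i x = x(i := - x i)"

lemma flip_in_hypercube:
  assumes "x \<in> hypercube n" "i < n"
  shows "flip i x \<in> hypercube n"
  using assms by (auto simp: flip_def hypercube_def PiE_iff extensional_def)

lemma hypercube_adj_iff_flip:
  assumes x: "x \<in> hypercube n" and y: "y \<in> hypercube n"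
  shows "hypercube_adj n x y \<longleftrightarrow> (\<exists>i<n. y = flip i x)"
proof
  assume "hypercube_adj n x y"
  then obtain i where i: "i < n" "x i \<noteq> y i" and same: "\<And>j. j < n \<Longrightarrow> j \<noteq> i \<Longrightarrow> x j = y j"
    unfolding hypercube_adj_def by blast
  have "y = flip i x"
  proof
    fix j
    show "y j = flip i x j"
    proof (cases "j < n")
      case True
      then show ?thesis
        using i same[of j] hypercube_coordinate[OF x i(1)] hypercube_coordinate[OF y i(1)]
        by (auto simp: flip_def)
    next
      case False
      then show ?thesis
        using x y i by (auto simp: flip_def hypercube_def PiE_iff extensional_def)
    qed
  qed
  with i show "\<exists>i<n. y = flip i x"
    by blast
next
  assume "\<exists>i<n. y = flip i x"
  then obtain i where i: "i < n" "y = flip i x"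
    by blast
  then show "hypercube_adj n x y"
    using hypercube_coordinate[OF x i(1)] unfolding hypercube_adj_def
    by (intro ex1I[of _ i]) (auto simp: flip_def split: if_splits)
qed

lemma card_hypercube_neighbours:
  assumes x: "x \<in> hypercube n"
  shows "card {u\<in>hypercube n. hypercube_adj n x u \<and> P u} = card {i. i < n \<and> P (flip i x)}"
proof -
  have "{u\<in>hypercube n. hypercube_adj n x u \<and> P u} = (\<lambda>i. flip i x) ` {i. i < n \<and> P (flip i x)}"
    using hypercube_adj_iff_flip[OF x] flip_in_hypercube[OF x] by auto
  moreover have "inj_on (\<lambda>i. flip i x) {i. i < n \<and> P (flip i x)}"
  proof (rule inj_onI)
    fix i j assume "i \<in> {i. i < n \<and> P (flip i x)}" and eq: "flip i x = flip j x"
    then have "x i \<noteq> 0"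
      using hypercube_coordinate[OF x, of i] by auto
    then show "i = j"
      using fun_cong[OF eq, of i] by (auto simp: flip_def split: if_splits)
  qed
  ultimately show ?thesis
    by (simp add: card_image)
qed

lemma locally_stable_hypercubeI:
  assumes f: "f \<in> hypercube_functions n"
    and c: "\<And>x. x \<in> hypercube n \<Longrightarrow> card {i. i < n \<and> f (flip i x) \<noteq> f x} = c"
  shows "locally_stable (hypercube n) (hypercube_adj n) n c f"
  using assms card_hypercube_neighbours[of _ n "\<lambda>_. True"] card_hypercube_neighbours
  by (auto simp: locally_stable_def PiE_iff)

definition product_fn :: "nat \<Rightarrow> vertex \<Rightarrow> int" where
  "product_fn n = (\<lambda>x\<in>hypercube n. x 0 * x 1)"

text \<open>The coordinates \<open>2\<close> and \<open>3\<close> select which of \<open>x 0\<close> and \<open>x 1\<close> is multiplied by \<open>x 2\<close>.\<close>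

definition switch_fn :: "nat \<Rightarrow> vertex \<Rightarrow> int" where
  "switch_fn n = (\<lambda>x\<in>hypercube n. (if x 2 = x 3 then x 0 else x 1) * x 2)"

lemma product_fn_hypercube:
  assumes "n \<ge> 2"
  shows "product_fn n \<in> hypercube_functions n"
proof -
  have "x 0 * x 1 \<in> {-1, 1}" if "x \<in> hypercube n" for x
    using hypercube_coordinate[OF that, of 0] hypercube_coordinate[OF that, of 1] assms by auto
  then show ?thesis
    by (simp add: product_fn_def)
qed

lemma switch_fn_hypercube:
  assumes "n \<ge> 4"
  shows "switch_fn n \<in> hypercube_functions n"
proof -
  have "(if x 2 = x 3 then x 0 else x 1) * x 2 \<in> {-1, 1}" if "x \<in> hypercube n" for x
    using hypercube_coordinate[OF that, of 0] hypercube_coordinate[OF that, of 1]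
      hypercube_coordinate[OF that, of 2] assms by auto
  then show ?thesis
    by (simp add: switch_fn_def)
qed

lemma product_fn_flip:
  assumes "n \<ge> 2" "x \<in> hypercube n" "i < n"
  shows "product_fn n (flip i x) \<noteq> product_fn n x \<longleftrightarrow> i = 0 \<or> i = 1"
  using assms hypercube_coordinate[of x n 0] hypercube_coordinate[of x n 1]
    flip_in_hypercube[of x n i]
  by (auto simp: product_fn_def flip_def)

text \<open>Of the coordinates \<open>0\<close> and \<open>1\<close> only the selected one matters. Flipping \<open>2\<close> or \<open>3\<close> changes
  the selection; flipping \<open>2\<close> also changes the sign. If \<open>x 0 = x 1\<close>, a changed selection has
  no effect, so that only the flip of \<open>2\<close> is seen. If \<open>x 0 = - x 1\<close>, a changed selection is itself
  a change of sign: it is seen when \<open>3\<close> is flipped, and it cancels the change of sign of \<open>x 2\<close>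
  when \<open>2\<close> is flipped.\<close>

lemma switch_fn_flip:
  assumes "n \<ge> 4" "x \<in> hypercube n" "i < n"
  shows "switch_fn n (flip i x) \<noteq> switch_fn n x \<longleftrightarrow>
    i = (if x 2 = x 3 then 0 else 1) \<or> i = (if x 0 = x 1 then 2 else 3)"
proof -
  have "x 0 = -1 \<or> x 0 = 1" "x 1 = -1 \<or> x 1 = 1" "x 2 = -1 \<or> x 2 = 1" "x 3 = -1 \<or> x 3 = 1"
    by (rule hypercube_coordinate[OF assms(2)]; use assms in simp)+
  moreover have "i = 0 \<or> i = 1 \<or> i = 2 \<or> i = 3 \<or> i \<notin> {0, 1, 2, 3}"
    by auto
  ultimately show ?thesis
    using assms flip_in_hypercube[of x n i]
    by (elim disjE) (simp_all add: switch_fn_def flip_def)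
qed

lemma product_fn_stable:
  assumes "n \<ge> 2"
  shows "locally_stable (hypercube n) (hypercube_adj n) n 2 (product_fn n)"
proof (rule locally_stable_hypercubeI[OF product_fn_hypercube[OF assms]])
  fix x assume "x \<in> hypercube n"
  then have "{i. i < n \<and> product_fn n (flip i x) \<noteq> product_fn n x} = {i. i < n \<and> (i = 0 \<or> i = 1)}"
    using product_fn_flip[OF assms] by blast
  also have "\<dots> = {0, 1}"
    using assms by auto
  finally show "card {i. i < n \<and> product_fn n (flip i x) \<noteq> product_fn n x} = 2"
    by simp
qed

lemma switch_fn_stable:
  assumes "n \<ge> 4"
  shows "locally_stable (hypercube n) (hypercube_adj n) n 2 (switch_fn n)"
proof (rule locally_stable_hypercubeI[OF switch_fn_hypercube[OF assms]])
  fix x assume "x \<in> hypercube n"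
  then have "{i. i < n \<and> switch_fn n (flip i x) \<noteq> switch_fn n x} =
      {i. i < n \<and> (i = (if x 2 = x 3 then 0 else 1) \<or> i = (if x 0 = x 1 then 2 else 3))}"
    using switch_fn_flip[OF assms] by blast
  also have "\<dots> = {if x 2 = x 3 then 0 else 1, if x 0 = x 1 then 2 else 3}"
    using assms by auto
  finally show "card {i. i < n \<and> switch_fn n (flip i x) \<noteq> switch_fn n x} = 2"
    by simp
qed


section \<open>The two functions are not isomorphic\<close>

text \<open>The vertices \<open>x, y, w, z\<close> form a 4-cycle with a single value \<open>1\<close>, at \<open>x\<close>. The case \<open>w = x\<close> is
  excluded by the values.\<close>

definition has_odd_square :: "nat \<Rightarrow> (vertex \<Rightarrow> int) \<Rightarrow> bool" where
  "has_odd_square n f \<longleftrightarrow> (\<exists>x\<in>hypercube n. \<exists>y\<in>hypercube n. \<exists>z\<in>hypercube n. \<exists>w\<in>hypercube n.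
     y \<noteq> z \<and> hypercube_adj n x y \<and> hypercube_adj n x z \<and> hypercube_adj n y w \<and> hypercube_adj n z w \<and>
     f x = 1 \<and> f y = -1 \<and> f z = -1 \<and> f w = -1)"

lemma isomorphic_has_odd_square:
  assumes "isomorphic_functions n f g"
  shows "has_odd_square n f \<longleftrightarrow> has_odd_square n g"
proof -
  let ?V = "hypercube n"
  obtain \<psi> where bij: "bij_betw \<psi> ?V ?V"
    and adj: "\<And>x y. x \<in> ?V \<Longrightarrow> y \<in> ?V \<Longrightarrow> hypercube_adj n (\<psi> x) (\<psi> y) \<longleftrightarrow> hypercube_adj n x y"
    and fg: "\<And>x. x \<in> ?V \<Longrightarrow> f (\<psi> x) = g x"
    using assms unfolding isomorphic_functions_def graph_automorphism_def by blast
  have image: "\<psi> ` ?V = ?V" and inj: "\<And>x y. x \<in> ?V \<Longrightarrow> y \<in> ?V \<Longrightarrow> \<psi> x = \<psi> y \<longleftrightarrow> x = y"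
    using bij by (auto simp: bij_betw_def inj_on_eq_iff)
  have "has_odd_square n f \<longleftrightarrow>
    (\<exists>x\<in>\<psi> ` ?V. \<exists>y\<in>\<psi> ` ?V. \<exists>z\<in>\<psi> ` ?V. \<exists>w\<in>\<psi> ` ?V.
     y \<noteq> z \<and> hypercube_adj n x y \<and> hypercube_adj n x z \<and> hypercube_adj n y w \<and> hypercube_adj n z w \<and>
     f x = 1 \<and> f y = -1 \<and> f z = -1 \<and> f w = -1)"
    by (simp only: has_odd_square_def image)
  also have "\<dots> \<longleftrightarrow> has_odd_square n g"
    by (simp add: has_odd_square_def adj fg inj cong: bex_cong)
  finally show ?thesis .
qed

text \<open>Along an edge where \<open>x 0 * x 1\<close> changes, only coordinate \<open>0\<close> or \<open>1\<close> is flipped; along an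
  edge where it does not, these two coordinates are kept. In an odd square \<open>y\<close> and \<open>z\<close> would
  agree with \<open>w\<close> on the coordinates \<open>0\<close> and \<open>1\<close> and with \<open>x\<close> on all others, so they would
  coincide.\<close>

lemma product_fn_no_odd_square:
  assumes n: "n \<ge> 2"
  shows "\<not> has_odd_square n (product_fn n)"
proof
  let ?V = "hypercube n" and ?f = "product_fn n"
  assume "has_odd_square n ?f"
  then obtain x y z w where V: "x \<in> ?V" "y \<in> ?V" "z \<in> ?V" "w \<in> ?V" and "y \<noteq> z"
    and adj: "hypercube_adj n x y" "hypercube_adj n x z" "hypercube_adj n y w" "hypercube_adj n z w"
    and val: "?f x = 1" "?f y = -1" "?f z = -1" "?f w = -1"
    unfolding has_odd_square_def by blast
  have step: "\<exists>i<n. v = flip i u \<and> (?f u \<noteq> ?f v \<longleftrightarrow> i = 0 \<or> i = 1)"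
    if uv: "u \<in> ?V" "v \<in> ?V" "hypercube_adj n u v" for u v
  proof -
    obtain i where i: "i < n" "v = flip i u"
      using hypercube_adj_iff_flip[OF uv(1,2)] uv(3) by blast
    show ?thesis
      using i product_fn_flip[OF n uv(1) i(1)] by (intro exI[of _ i]) auto
  qed
  have differ: "u j = v j"
    if "u \<in> ?V" "v \<in> ?V" "hypercube_adj n u v" "?f u \<noteq> ?f v" "j \<noteq> 0" "j \<noteq> 1" for u v j
    using step[OF that(1-3)] that(4-6) by (auto simp: flip_def)
  have agree: "u j = v j"
    if "u \<in> ?V" "v \<in> ?V" "hypercube_adj n u v" "?f u = ?f v" "j = 0 \<or> j = 1" for u v j
    using step[OF that(1-3)] that(4-5) by (auto simp: flip_def)
  have "y j = z j" for j
  proof (cases "j = 0 \<or> j = 1")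
    case True
    then show ?thesis
      using agree[of y w j] agree[of z w j] V adj val by simp
  next
    case False
    then show ?thesis
      using differ[of x y j] differ[of x z j] V adj val by simp
  qed
  with \<open>y \<noteq> z\<close> show False
    by auto
qed

text \<open>Start from the all-ones vertex and flip coordinates \<open>0\<close> and \<open>2\<close>. Each flip alone changes the
  value. After the flip of \<open>2\<close> the selected coordinate is \<open>1\<close>, so that the flip of \<open>0\<close> is no
  longer seen.\<close>

lemma switch_fn_odd_square:
  assumes n: "n \<ge> 4"
  shows "has_odd_square n (switch_fn n)"
proof -
  define x :: vertex where "x = (\<lambda>i\<in>{..<n}. 1)"
  have x: "x \<in> hypercube n"
    by (auto simp: x_def hypercube_def)
  let ?y = "flip 0 x" and ?z = "flip 2 x" and ?w = "flip 2 (flip 0 x)"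
  have V: "?y \<in> hypercube n" "?z \<in> hypercube n" "?w \<in> hypercube n"
    using x n by (auto intro!: flip_in_hypercube)
  have w: "?w = flip 0 ?z"
    by (auto simp: flip_def)
  have adj: "hypercube_adj n u (flip i u)" if "u \<in> hypercube n" "i < n" for u i
    using hypercube_adj_iff_flip[OF that(1) flip_in_hypercube[OF that]] that(2) by blast
  have "hypercube_adj n x ?y" "hypercube_adj n x ?z" "hypercube_adj n ?y ?w"
    using n by (auto intro!: adj x V(1))
  moreover have "hypercube_adj n ?z ?w"
    unfolding w using n by (intro adj V(2)) simp
  moreover have "?y \<noteq> ?z"
    using n by (auto simp: flip_def x_def fun_eq_iff)
  moreover have "switch_fn n x = 1" "switch_fn n ?y = -1" "switch_fn n ?z = -1" "switch_fn n ?w = -1"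
    using x V n by (simp_all add: switch_fn_def flip_def x_def)
  ultimately show ?thesis
    using x V unfolding has_odd_square_def by blast
qed


theorem corollary4p5:
  fixes n :: nat and M :: "'a measure" and S :: "nat \<Rightarrow> 'a \<Rightarrow> vertex"
  assumes "n \<ge> 5"
    and "simple_random_walk (hypercube n) (hypercube_adj n) M S"
  shows "\<not> (\<exists>R. R \<in> sign_sequences \<rightarrow>\<^sub>M count_space (hypercube_functions n) \<and>
               (\<forall>f\<in>hypercube_functions n.
                  AE \<omega> in M. isomorphic_functions n (R (scenery f S \<omega>)) f))"
proof
  let ?f = "product_fn n" and ?g = "switch_fn n"
  assume "\<exists>R. R \<in> sign_sequences \<rightarrow>\<^sub>M count_space (hypercube_functions n) \<and>
               (\<forall>f\<in>hypercube_functions n.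
                  AE \<omega> in M. isomorphic_functions n (R (scenery f S \<omega>)) f)"
  then obtain R where R: "R \<in> sign_sequences \<rightarrow>\<^sub>M count_space (hypercube_functions n)"
    and iso: "\<And>f. f \<in> hypercube_functions n \<Longrightarrow>
      AE \<omega> in M. isomorphic_functions n (R (scenery f S \<omega>)) f"
    by blast
  have n: "n \<ge> 2" "n \<ge> 4" "n > 0"
    using assms(1) by auto
  have prob: "prob_space M" and meas: "\<And>i. S i \<in> M \<rightarrow>\<^sub>M count_space (hypercube n)"
    using assms(2) by (simp_all add: simple_random_walk_def)
  have fg: "?f \<in> hypercube_functions n" "?g \<in> hypercube_functions n"
    using product_fn_hypercube switch_fn_hypercube n by auto
  have law: "distr M sign_sequences (scenery ?f S) = distr M sign_sequences (scenery ?g S)"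
    using locally_stable_scenery_law[OF assms(2) finite_hypercube hypercube_nonempty
        hypercube_adj_sym product_fn_stable switch_fn_stable] n by simp
  have scen: "scenery h S \<in> M \<rightarrow>\<^sub>M sign_sequences" if "h \<in> hypercube_functions n" for h
    using that by (intro scenery_measurable[OF meas]) (auto simp: PiE_iff)
  obtain h where "isomorphic_functions n h ?f" "isomorphic_functions n h ?g"
    using equal_scenery_laws_common_reconstruction[where P = "\<lambda>h. isomorphic_functions n h ?f"
        and Q = "\<lambda>h. isomorphic_functions n h ?g", OF prob scen[OF fg(1)] scen[OF fg(2)] law R
        iso[OF fg(1)] iso[OF fg(2)]] by blast
  then have "has_odd_square n ?f \<longleftrightarrow> has_odd_square n ?g"
    using isomorphic_has_odd_square by blast
  then show False
    using product_fn_no_odd_square switch_fn_odd_square n by blast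
qed

end
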